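(* Let $m \geq 1$ be an integer and let $R \subseteq \{0,1,\ldots,m-1\}$. Let $A^{+}$ be the set of all integers $a \geq m$ such that $a \bmod m \in R$. Then for every nonnegative integer $n$, $$p_{A^{+}}(n) \leq \exp\!\left(\pi\sqrt{\frac{2n|R|}{3m}}\right),$$ equivalently $\log p_{A^{+}}(n) \leq \pi\sqrt{2n|R|/(3m)}$ whenever $p_{A^{+}}(n)>0$.
   Context: For a set $S$ of positive integers, $p_S(n)$ denotes the number of partitions of $n$ with all summands in $S$, i.e., the number of ways to write $n$ as a sum of elements of $S$ where the order of the summands does not matter (so $p_S(0)=1$). Here $a \bmod m$ denotes the residue of $a$ modulo $m$ in $\{0,1,\ldots,m-1\}$. *)

theory Defs
  imports "HOL-Analysis.Analysis" "HOL-Library.Multiset"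
begin

text \<open>
  A partition of \<open>n\<close> is represented by the multiset of its summands.  The definition is
  meaningful only for sets \<open>S\<close> of positive integers: if \<open>0 \<in> S\<close>, the set below is infinite (or
  empty) and the cardinality is the default value 0.
\<close>

definition partitions_with :: "nat set \<Rightarrow> nat \<Rightarrow> nat multiset set" where
  "partitions_with S n = {M. set_mset M \<subseteq> S \<and> sum_mset M = n}"

definition num_partitions :: "nat set \<Rightarrow> nat \<Rightarrow> nat" where
  "num_partitions S n = card (partitions_with S n)"

lemma finite_partitions_with:
  assumes "0 \<notin> S"
  shows "finite (partitions_with S n)"
proof (rule finite_subset)
  let ?L = "{xs. set xs \<subseteq> {..n} \<and> length xs \<le> n}"
  show "finite (mset ` ?L)"
    by (intro finite_imageI finite_lists_length_le) simp
  show "partitions_with S n \<subseteq> mset ` ?L"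
  proof
    fix M assume M: "M \<in> partitions_with S n"
    obtain xs where xs: "mset xs = M" using ex_mset by blast
    have sum: "sum_list xs = n" and pos: "0 \<notin> set xs"
      using M xs assms by (auto simp: partitions_with_def sum_mset_sum_list)
    have "length xs \<le> sum_list xs" using pos by (induction xs) auto
    moreover have "set xs \<subseteq> {..n}" using sum member_le_sum_list by fastforce
    ultimately show "M \<in> mset ` ?L" using xs sum by auto
  qed
qed

lemma num_partitions_0: "0 \<notin> S \<Longrightarrow> num_partitions S 0 = 1"
proof -
  assume "0 \<notin> S"
  then have "partitions_with S 0 = {{#}}"
    by (auto simp: partitions_with_def) (metis multiset_nonemptyE subsetD)
  then show ?thesis by (simp add: num_partitions_def)
qed

end

theory Submission
  imports Defs
begin

text \<open>
  For \<open>0 < x < 1\<close> the product \<open>P(x)\<close> of the factors \<open>1 / (1 - x ^ a)\<close> over \<open>a \<in> A\<close> is the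
  generating function of the partition numbers, so \<open>p(n) \<le> P(x) / x ^ n\<close>. With \<open>x = exp (- t)\<close>,
  expand \<open>ln P(x)\<close> as the sum over \<open>k \<ge> 1\<close> and \<open>a \<in> A\<close> of \<open>exp (- k t a) / k\<close>. Since all
  elements of \<open>A\<close> are at least \<open>m\<close>, each residue class contributes at most
  \<open>1 / (exp (k m t) - 1) \<le> 1 / (k m t)\<close> to the inner sum, and Basel's series gives
  \<open>ln P(x) \<le> |R| pi\<^sup>2 / (6 m t)\<close>. The claim follows by choosing the \<open>t\<close> that minimises
  \<open>n t + |R| pi\<^sup>2 / (6 m t)\<close>. Only the parts up to \<open>n\<close> matter, so that finite products suffice.
\<close>

lemma sum_geometric_le:
  fixes y :: real
  assumes "0 \<le> y" "y < 1"
  shows "(\<Sum>k<K. y ^ k) \<le> 1 / (1 - y)"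
  using assms sum_le_suminf[of "\<lambda>k. y ^ k" "{..<K}"] by (simp add: suminf_geometric summable_geometric)

text \<open>By induction on \<open>S\<close>: a multiset is determined by its part away from
  \<open>a\<close> and its multiplicity of \<open>a\<close>, so the sum is dominated by a sum over
  smaller multisets times a geometric sum. Letting \<open>F\<close> be any finite family avoids
  infinite sums and lets the induction pass to \<open>F'\<close>.\<close>

lemma sum_power_multisets_le:
  fixes x :: real and S :: "nat set" and F :: "nat multiset set"
  assumes "finite S" "0 \<notin> S" "finite F" "\<And>M. M \<in> F \<Longrightarrow> set_mset M \<subseteq> S" "0 \<le> x" "x < 1"
  shows "(\<Sum>M\<in>F. x ^ sum_mset M) \<le> (\<Prod>a\<in>S. 1 / (1 - x ^ a))"
  using assms(1-4)
proof (induction S arbitrary: F rule: finite_induct)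
  case empty
  then have "F \<subseteq> {{#}}" by auto
  then have "F = {} \<or> F = {{#}}" by blast
  then show ?case by auto
next
  case (insert a S)
  define F' where "F' = filter_mset (\<lambda>b. b \<noteq> a) ` F"
  \<comment> \<open>A crude strict upper bound for all multiplicities of \<open>a\<close> in
    \<open>F\<close>, valid also for empty \<open>F\<close>.\<close>
  define K where "K = Suc (\<Sum>M\<in>F. count M a)"
  define f where "f = (\<lambda>(M, k). M + replicate_mset k a)"
  have "a > 0" using insert.prems by auto
  then have xa: "0 \<le> x ^ a" "x ^ a < 1"
    using assms by (auto simp: power_less_one_iff)
  have F': "set_mset M \<subseteq> S" if M: "M \<in> F'" for M
  proof -
    obtain N where "N \<in> F" "M = filter_mset (\<lambda>b. b \<noteq> a) N" using M by (auto simp: F'_def)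
    then show ?thesis using insert.prems(3)[of N] by auto
  qed
  have pos: "0 \<le> (\<Prod>a\<in>S. 1 / (1 - x ^ a))"
    using assms by (intro prod_nonneg) (simp add: power_le_one)
  have "F \<subseteq> f ` (F' \<times> {..<K})"
  proof
    fix M assume M: "M \<in> F"
    have "M = filter_mset (\<lambda>b. b \<noteq> a) M + replicate_mset (count M a) a"
      by (intro multiset_eqI) auto
    moreover have "count M a < K"
      unfolding K_def using M insert.prems member_le_sum[of M F "\<lambda>M. count M a"] by auto
    ultimately show "M \<in> f ` (F' \<times> {..<K})"
      using M by (auto simp: F'_def f_def intro!: image_eqI[of _ _ "(_, count M a)"])
  qed
  then have "(\<Sum>M\<in>F. x ^ sum_mset M) \<le> (\<Sum>M\<in>f ` (F' \<times> {..<K}). x ^ sum_mset M)"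
    using assms insert.prems by (intro sum_mono2) (auto simp: F'_def)
  also have "\<dots> \<le> (\<Sum>p\<in>F' \<times> {..<K}. x ^ sum_mset (f p))"
    using assms insert.prems sum_image_le[of "F' \<times> {..<K}" "\<lambda>M. x ^ sum_mset M" f] by (auto simp: F'_def)
  also have "\<dots> = (\<Sum>M\<in>F'. \<Sum>k<K. x ^ sum_mset M * (x ^ a) ^ k)"
    by (simp add: sum.cartesian_product f_def case_prod_unfold power_add mult.commute flip: power_mult)
  also have "\<dots> = (\<Sum>M\<in>F'. x ^ sum_mset M) * (\<Sum>k<K. (x ^ a) ^ k)"
    by (simp add: sum_product)
  also have "\<dots> \<le> (\<Prod>a\<in>S. 1 / (1 - x ^ a)) * (1 / (1 - x ^ a))"
    using insert.prems pos assms(5,6) xa F'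
    by (intro mult_mono insert.IH sum_geometric_le sum_nonneg) (simp_all add: F'_def)
  finally show ?case
    using insert.hyps by (simp add: mult.commute)
qed

lemma num_partitions_le_prod:
  fixes x :: real
  assumes "finite S" "0 \<notin> S" "0 \<le> x" "x < 1"
  shows "num_partitions S n * x ^ n \<le> (\<Prod>a\<in>S. 1 / (1 - x ^ a))"
proof -
  have "(\<Sum>M\<in>partitions_with S n. x ^ sum_mset M) = num_partitions S n * x ^ n"
    by (simp add: num_partitions_def partitions_with_def)
  moreover have "(\<Sum>M\<in>partitions_with S n. x ^ sum_mset M) \<le> (\<Prod>a\<in>S. 1 / (1 - x ^ a))"
    using assms finite_partitions_with[OF assms(2)]
    by (intro sum_power_multisets_le) (auto simp: partitions_with_def)
  ultimately show ?thesis by simp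
qed

text \<open>Elements of \<open>B\<close> have the form \<open>r + m * Suc q\<close> with
  \<open>r\<close> in \<open>R\<close>. Dropping \<open>r\<close> only increases the power of
  \<open>y\<close>, which leaves one geometric series per residue.\<close>

lemma sum_power_residues_le:
  fixes y :: real and m :: nat
  assumes "R \<subseteq> {0..<m}" "finite B" "B \<subseteq> {a. a \<ge> m \<and> a mod m \<in> R}" "0 \<le> y" "y < 1" "m \<ge> 1"
  shows "(\<Sum>a\<in>B. y ^ a) \<le> card R * (y ^ m / (1 - y ^ m))"
proof -
  define K where "K = Suc (\<Sum>a\<in>B. a div m)"
  define f where "f = (\<lambda>(r, q). r + m * Suc q)"
  have fin: "finite R" using assms(1) finite_subset by blast
  have ym: "0 \<le> y ^ m" "y ^ m < 1"
    using assms by (auto simp: power_less_one_iff)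
  have "B \<subseteq> f ` (R \<times> {..<K})"
  proof
    fix a assume a: "a \<in> B"
    then have am: "a \<ge> m" "a mod m \<in> R" using assms(3) by auto
    \<comment> \<open>Here \<open>a \<ge> m\<close> enters: the quotient is at least 1, so the
      truncated subtraction is exact.\<close>
    then have d: "Suc (a div m - 1) = a div m"
      using assms(6) by (simp add: div_greater_zero_iff)
    have "a div m < K"
      unfolding K_def using a assms(2) member_le_sum[of a B "\<lambda>a. a div m"] by auto
    then have "(a mod m, a div m - 1) \<in> R \<times> {..<K}" using am by auto
    moreover have "a = f (a mod m, a div m - 1)" unfolding f_def split_conv d by simp
    ultimately show "a \<in> f ` (R \<times> {..<K})" by blast
  qed
  then have "(\<Sum>a\<in>B. y ^ a) \<le> (\<Sum>a\<in>f ` (R \<times> {..<K}). y ^ a)"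
    using assms fin by (intro sum_mono2) auto
  also have "\<dots> \<le> (\<Sum>p\<in>R \<times> {..<K}. y ^ f p)"
    using assms fin sum_image_le[of "R \<times> {..<K}" "\<lambda>a. y ^ a" f] by auto
  also have "\<dots> \<le> (\<Sum>p\<in>R \<times> {..<K}. y ^ (m * Suc (snd p)))"
    using assms by (intro sum_mono power_decreasing) (auto simp: f_def)
  also have "\<dots> = card R * (\<Sum>q<K. y ^ (m * Suc q))"
    using sum.cartesian_product[of "\<lambda>_ q. y ^ (m * Suc q)" "{..<K}" R] by (simp add: case_prod_unfold)
  also have "(\<Sum>q<K. y ^ (m * Suc q)) = y ^ m * (\<Sum>q<K. (y ^ m) ^ q)"
    by (simp add: sum_distrib_left power_add flip: power_mult)
  also have "\<dots> \<le> y ^ m * (1 / (1 - y ^ m))"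
    using ym by (intro mult_left_mono sum_geometric_le)
  finally show ?thesis by (simp add: mult_left_mono)
qed

lemma exp_geometric_le:
  fixes s :: real
  assumes "s > 0"
  shows "exp (-s) / (1 - exp (-s)) \<le> 1 / s"
proof -
  have "exp (-s) / (1 - exp (-s)) = 1 / (exp s - 1)"
    using assms by (simp add: exp_minus field_simps)
  also have "\<dots> \<le> 1 / s"
    using assms exp_gt_one[of s] exp_ge_add_one_self[of s]
    by (intro divide_left_mono mult_pos_pos) linarith+
  finally show ?thesis .
qed

text \<open>Expand each \<open>- ln (1 - x ^ a)\<close> in powers of \<open>x ^ a\<close> and
  compare, for each exponent, the sum over \<open>B\<close> with a term of Basel's series.\<close>

lemma prod_residues_le:
  fixes t :: real and m :: nat
  assumes "R \<subseteq> {0..<m}" "finite B" "B \<subseteq> {a. a \<ge> m \<and> a mod m \<in> R}" "t > 0" "m \<ge> 1"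
  shows "(\<Prod>a\<in>B. 1 / (1 - exp (-t) ^ a)) \<le> exp (card R * pi\<^sup>2 / (6 * real m * t))"
proof -
  define x where "x = exp (-t)"
  have x: "0 < x" "x < 1" using assms by (auto simp: x_def)
  have xa: "0 < x ^ a" "x ^ a < 1" if "a \<in> B" for a
    using that assms x by (auto simp: power_less_one_iff)
  have ser: "(\<lambda>k. (x ^ a) ^ Suc k / real (Suc k)) sums (- ln (1 - x ^ a))" if "a \<in> B" for a
  proof -
    have "(\<lambda>k. - ((x ^ a) ^ k) / real k) sums ln (1 - x ^ a)"
      using xa[OF that] ln_series'[of "- (x ^ a)"] by simp
    then have "(\<lambda>k. (x ^ a) ^ k / real k) sums (- ln (1 - x ^ a))"
      using sums_minus by fastforce
    \<comment> \<open>The term at \<open>k = 0\<close> is a division by zero, hence 0, so the index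
      may be shifted.\<close>
    then show ?thesis by (subst sums_Suc_iff) simp
  qed
  have lhs: "(\<lambda>k. \<Sum>a\<in>B. (x ^ a) ^ Suc k / real (Suc k)) sums (\<Sum>a\<in>B. - ln (1 - x ^ a))"
    by (intro sums_sum ser)
  have rhs: "(\<lambda>k. card R / (real m * t) * (1 / (real k + 1)\<^sup>2)) sums (card R / (real m * t) * (pi\<^sup>2 / 6))"
    by (intro sums_mult) (use inverse_squares_sums in \<open>simp add: add.commute\<close>)
  have "(\<Sum>a\<in>B. (x ^ a) ^ Suc k / real (Suc k)) \<le> card R / (real m * t) * (1 / (real k + 1)\<^sup>2)" for k
  proof -
    \<comment> \<open>Since \<open>(x ^ a) ^ Suc k = y ^ a\<close>, the residue bound applies to
      \<open>y\<close>. It yields one factor \<open>1 / Suc k\<close>, and the logarithmic series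
      supplies the other.\<close>
    define y where "y = x ^ Suc k"
    have y: "0 \<le> y" "y < 1" using x unfolding y_def by (auto simp: power_less_one_iff simp del: power_Suc)
    have ym: "y ^ m = exp (- (real (Suc k) * real m * t))"
      unfolding y_def x_def by (simp flip: exp_of_nat_mult power_mult del: power_Suc of_nat_Suc)
    have "(\<Sum>a\<in>B. (x ^ a) ^ Suc k / real (Suc k)) = (\<Sum>a\<in>B. y ^ a) / real (Suc k)"
      by (simp only: y_def sum_divide_distrib mult.commute flip: power_mult)
    also have "\<dots> \<le> card R * (1 / (real (Suc k) * real m * t)) / real (Suc k)"
      using assms by (intro divide_right_mono order.trans[OF sum_power_residues_le[OF assms(1-3) y assms(5)]]
          mult_left_mono) (auto simp: ym intro!: exp_geometric_le)
    also have "\<dots> = card R / (real m * t) * (1 / (real k + 1)\<^sup>2)"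
      by (simp add: power2_eq_square algebra_simps)
    finally show ?thesis .
  qed
  then have "(\<Sum>a\<in>B. - ln (1 - x ^ a)) \<le> card R / (real m * t) * (pi\<^sup>2 / 6)"
    by (rule sums_le[OF _ lhs rhs])
  moreover have "(\<Prod>a\<in>B. 1 / (1 - x ^ a)) = exp (\<Sum>a\<in>B. - ln (1 - x ^ a))"
    unfolding exp_sum[OF assms(2)] using xa by (intro prod.cong) (auto simp: exp_minus field_simps)
  ultimately show ?thesis by (simp add: x_def mult_ac)
qed

theorem theorem1:
  fixes m n :: nat and R A :: "nat set"
  assumes m: "m \<ge> 1"
    and R: "R \<subseteq> {0..<m}"
    and A: "A = {a. a \<ge> m \<and> a mod m \<in> R}"
  shows "real (num_partitions A n) \<le> exp (pi * sqrt (2 * real n * real (card R) / (3 * real m)))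
    \<and> (num_partitions A n > 0 \<longrightarrow>
         ln (real (num_partitions A n)) \<le> pi * sqrt (2 * real n * real (card R) / (3 * real m)))"
proof -
  define c where "c = pi * sqrt (2 * real n * real (card R) / (3 * real m))"
  have A0: "0 \<notin> A" using m A by auto
  have "num_partitions A n \<le> exp c"
  \<comment> \<open>In these degenerate cases \<open>c = 0\<close>, so no positive \<open>t\<close>
    arises from \<open>c\<close>, and at most one partition exists.\<close>
  proof (cases "n = 0 \<or> R = {}")
    case True
    have "num_partitions A n \<le> 1"
    proof (cases "n = 0")
      case False
      then have "A = {}" using True A by auto
      then have "partitions_with A n = {}" using False by (auto simp: partitions_with_def)
      then show ?thesis by (simp add: num_partitions_def)
    qed (use A0 num_partitions_0 in simp)
    moreover have "c = 0" using True by (auto simp: c_def)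
    ultimately show ?thesis by simp
  next
    case False
    then have card: "card R > 0" using R finite_subset by (auto simp: card_gt_0_iff)
    define B where "B = A \<inter> {..n}"
    \<comment> \<open>The minimiser of \<open>n * t + card R * pi\<^sup>2 / (6 * m * t)\<close>:
      both summands become \<open>c / 2\<close>.\<close>
    define t where "t = c / (2 * n)"
    have "c > 0" using False card m by (auto simp: c_def)
    then have t: "t > 0" using False by (simp add: t_def)
    have "c\<^sup>2 = pi\<^sup>2 * (2 * real n * real (card R) / (3 * real m))"
      by (simp add: c_def power_mult_distrib)
    then have "card R * pi\<^sup>2 / (6 * real m * t) = c / 2"
      using \<open>c > 0\<close> False m by (simp add: t_def field_simps power2_eq_square)
    moreover have "c = t * n + c / 2" using False by (simp add: t_def)
    ultimately have c: "c = n * t + card R * pi\<^sup>2 / (6 * real m * t)" by (simp add: mult.commute)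
    have "set_mset M \<subseteq> {..sum_mset M}" for M :: "nat multiset"
      by (auto simp: sum_mset.remove)
    then have "partitions_with A n = partitions_with B n"
      by (auto simp: partitions_with_def B_def)
    then have eq: "num_partitions A n = num_partitions B n" by (simp add: num_partitions_def)
    have "num_partitions B n * exp (-t) ^ n \<le> (\<Prod>a\<in>B. 1 / (1 - exp (-t) ^ a))"
      using t A0 by (intro num_partitions_le_prod) (auto simp: B_def)
    also have "\<dots> \<le> exp (card R * pi\<^sup>2 / (6 * real m * t))"
      using t m R A by (intro prod_residues_le) (auto simp: B_def)
    also have "exp (-t) ^ n = exp (- (n * t))"
      by (simp flip: exp_of_nat_mult)
    finally show ?thesis
      unfolding eq c exp_add by (simp add: exp_minus field_simps)
  qed
  moreover from this have "ln (num_partitions A n) \<le> c" if "num_partitions A n > 0"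
    using that ln_mono[of "real (num_partitions A n)" "exp c"] by simp
  ultimately show ?thesis by (simp add: c_def)
qed

end
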